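(* Let $\mathcal{B}_0=\{|\psi_{00}\rangle,|\psi_{10}\rangle\}$ and $\mathcal{B}_1=\{|\psi_{01}\rangle,|\psi_{11}\rangle\}$ be arbitrary distinct qubit orthogonal bases. Suppose that $d_{i\beta}=0$ and $\eta_{i\beta}=\eta_i\in(0,1)$ for $i,\beta\in\{0,1\}$, and that $\eta_0\neq\eta_1$. Alice sends Bob a pulse of $k$ photons encoding a state $\rho$, with $k\in\{0,1,2\}$ chosen by Alice and unknown to Bob. Then the only probabilistic reporting strategy $(S_{c_0c_1\beta})_{c_0,c_1,\beta\in\{0,1\}}$ (not identically zero) guaranteeing that Alice cannot obtain any information about $\beta$ from Bob's message $m$ is the trivial strategy. That is, for $S_{c_0c_1\beta}\in[0,1]$ not all equal to $0$, one has $$P_{\text{report}}(1|1,\rho,k)=P_{\text{report}}(1|0,\rho,k)\quad\text{for every } k\in\{0,1,2\}\text{ and every }k\text{-qubit state }\rho$$ if and only if there is $S\in(0,1]$ with $S_{c_0c_1\beta}=S$ for all $c_0,c_1,\beta\in\{0,1\}$.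
   Context: Model (setup I). For $\beta\in\{0,1\}$, $\mathcal{B}_\beta=\{|\psi_{0\beta}\rangle,|\psi_{1\beta}\rangle\}$ is an orthonormal basis of $\mathbb{C}^2$; two bases are distinct if they differ as unordered sets of states up to phases. Alice sends a pulse of $k\in\{0,1,2,\ldots\}$ photons encoding a $k$-qubit state $\rho$ (a density operator on $(\mathbb{C}^2)^{\otimes k}$; trivial for $k=0$). Bob measures every photon in $\mathcal{B}_\beta$, and a photon with outcome $|\psi_{i\beta}\rangle$ is sent to detector $D_i$. Thus the number $k_0$ of photons going to $D_0$ has distribution $$P(k_0|\beta,\rho)=\sum_{x\in\{0,1\}^k:\ |\{j:x_j=0\}|=k_0}\langle\psi_{x\beta}|\rho|\psi_{x\beta}\rangle,\qquad |\psi_{x\beta}\rangle=\bigotimes_{j=1}^k|\psi_{x_j\beta}\rangle,$$ and $k_1=k-k_0$ photons go to $D_1$. Detector $D_i$ has efficiency $\eta_{i\beta}\in(0,1)$ and dark count probability $d_{i\beta}\in[0,1)$ when Bob measures in $\mathcal{B}_\beta$. Given $k_0$, the two detectors click independently, and $D_i$ does not click with probability $(1-d_{i\beta})(1-\eta_{i\beta})^{k_i}$. $P_{\text{det}}(c_0,c_1|\beta,\rho,k)$ is the probability that, for each $i\in\{0,1\}$, $D_i$ clicks if $c_i=1$ and does not click if $c_i=0$. A probabilistic reporting strategy is a family $S_{c_0c_1\beta}\in[0,1]$, $c_0,c_1,\beta\in\{0,1\}$: when Bob measures in $\mathcal{B}_\beta$ and obtains detection event $(c_0,c_1)$, he sends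 Alice $m=1$ with probability $S_{c_0c_1\beta}$ and $m=0$ otherwise. Hence $$P_{\text{report}}(1|\beta,\rho,k)=\sum_{c_0,c_1\in\{0,1\}}S_{c_0c_1\beta}\,P_{\text{det}}(c_0,c_1|\beta,\rho,k).$$ A trivial strategy is one with $S_{c_0c_1\beta}=S$ for all $c_0,c_1,\beta$ and some $S\in(0,1]$. *)

theory Defs
  imports "Jordan_Normal_Form.Schur_Decomposition"
begin

text \<open>Bits (bases, detectors, outcomes, clicks) are the naturals 0 and 1; values of the
  parameter functions at other arguments are never used.\<close>

definition orthonormal_basis :: "nat \<Rightarrow> complex vec list \<Rightarrow> bool" where
  "orthonormal_basis n vs \<longleftrightarrow>
     set vs \<subseteq> carrier_vec n \<and>
     (\<forall>i<length vs. \<forall>j<length vs. vs ! i \<bullet>c vs ! j = (if i = j then 1 else 0)) \<and>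
     vectorspace.basis class_ring (module_vec TYPE(complex) n) (set vs)"

text \<open>The state represented by a ket: its class modulo phases.\<close>

definition ray :: "complex vec \<Rightarrow> complex vec set" where
  "ray v = {c \<cdot>\<^sub>v v | c. cmod c = 1}"

definition distinct_bases :: "complex vec set \<Rightarrow> complex vec set \<Rightarrow> bool" where
  "distinct_bases A B \<longleftrightarrow> ray ` A \<noteq> ray ` B"

text \<open>Kronecker product: the left factor is the most significant one in the index.\<close>

definition tensor_vec :: "complex vec \<Rightarrow> complex vec \<Rightarrow> complex vec" where
  "tensor_vec u v =
     vec (dim_vec u * dim_vec v) (\<lambda>i. u $ (i div dim_vec v) * v $ (i mod dim_vec v))"

definition tensor_list :: "complex vec list \<Rightarrow> complex vec" where
  "tensor_list vs = foldr tensor_vec vs (vec 1 (\<lambda>_. 1))"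

text \<open>Density operators on the k-qubit space, as matrices of size \<open>2 ^ k\<close>. The order on
  \<^typ>\<open>complex\<close> makes \<open>0 \<le> z\<close> mean that \<open>z\<close> is real and nonnegative.\<close>

definition qubit_state :: "nat \<Rightarrow> complex mat \<Rightarrow> bool" where
  "qubit_state k \<rho> \<longleftrightarrow>
     \<rho> \<in> carrier_mat (2 ^ k) (2 ^ k) \<and>
     mat_adjoint \<rho> = \<rho> \<and>
     (\<forall>v \<in> carrier_vec (2 ^ k). 0 \<le> (\<rho> *\<^sub>v v) \<bullet>c v) \<and>
     (\<Sum>i<2 ^ k. \<rho> $$ (i, i)) = 1"

text \<open>\<open>\<psi> i \<beta>\<close> is the ket with outcome \<open>i\<close> in basis \<open>\<beta>\<close>. The complex number
  \<open>\<langle>\<psi>\<^sub>x|\<rho>|\<psi>\<^sub>x\<rangle>\<close> below is real for every state, so \<^const>\<open>Re\<close> only changes its type.\<close>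

definition photon_count_prob ::
    "(nat \<Rightarrow> nat \<Rightarrow> complex vec) \<Rightarrow> nat \<Rightarrow> nat \<Rightarrow> complex mat \<Rightarrow> nat \<Rightarrow> real" where
  "photon_count_prob \<psi> k0 \<beta> \<rho> k =
     (\<Sum>x \<in> {x :: nat list. length x = k \<and> set x \<subseteq> {0, 1} \<and> card {j. j < k \<and> x ! j = 0} = k0}.
        let \<psi>x = tensor_list (map (\<lambda>i. \<psi> i \<beta>) x) in Re ((\<rho> *\<^sub>v \<psi>x) \<bullet>c \<psi>x))"

text \<open>Probability that a detector with efficiency \<open>e\<close> and dark count probability \<open>dk\<close>,
  receiving \<open>n\<close> photons, shows click value \<open>c\<close>.\<close>

definition click_prob :: "real \<Rightarrow> real \<Rightarrow> nat \<Rightarrow> nat \<Rightarrow> real" where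
  "click_prob e dk n c =
     (let no_click = (1 - dk) * (1 - e) ^ n in if c = 1 then 1 - no_click else no_click)"

definition P_det ::
    "(nat \<Rightarrow> nat \<Rightarrow> complex vec) \<Rightarrow> (nat \<Rightarrow> nat \<Rightarrow> real) \<Rightarrow> (nat \<Rightarrow> nat \<Rightarrow> real) \<Rightarrow>
     nat \<Rightarrow> nat \<Rightarrow> nat \<Rightarrow> complex mat \<Rightarrow> nat \<Rightarrow> real" where
  "P_det \<psi> \<eta> d c0 c1 \<beta> \<rho> k =
     (\<Sum>k0\<le>k. photon_count_prob \<psi> k0 \<beta> \<rho> k *
        click_prob (\<eta> 0 \<beta>) (d 0 \<beta>) k0 c0 * click_prob (\<eta> 1 \<beta>) (d 1 \<beta>) (k - k0) c1)"

text \<open>The probability of the message \<open>m = 1\<close>.\<close>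

definition P_report ::
    "(nat \<Rightarrow> nat \<Rightarrow> complex vec) \<Rightarrow> (nat \<Rightarrow> nat \<Rightarrow> real) \<Rightarrow> (nat \<Rightarrow> nat \<Rightarrow> real) \<Rightarrow>
     (nat \<Rightarrow> nat \<Rightarrow> nat \<Rightarrow> real) \<Rightarrow> nat \<Rightarrow> complex mat \<Rightarrow> nat \<Rightarrow> real" where
  "P_report \<psi> \<eta> d S \<beta> \<rho> k =
     (\<Sum>c0 \<in> {0, 1}. \<Sum>c1 \<in> {0, 1}. S c0 c1 \<beta> * P_det \<psi> \<eta> d c0 c1 \<beta> \<rho> k)"

definition reporting_strategy :: "(nat \<Rightarrow> nat \<Rightarrow> nat \<Rightarrow> real) \<Rightarrow> bool" where
  "reporting_strategy S \<longleftrightarrow> (\<forall>c0 \<in> {0, 1}. \<forall>c1 \<in> {0, 1}. \<forall>\<beta> \<in> {0, 1}. S c0 c1 \<beta> \<in> {0..1})"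

definition trivial_strategy :: "(nat \<Rightarrow> nat \<Rightarrow> nat \<Rightarrow> real) \<Rightarrow> bool" where
  "trivial_strategy S \<longleftrightarrow>
     (\<exists>s \<in> {0<..1}. \<forall>c0 \<in> {0, 1}. \<forall>c1 \<in> {0, 1}. \<forall>\<beta> \<in> {0, 1}. S c0 c1 \<beta> = s)"

end

theory Submission
  imports Defs
begin

text \<open>Let \<open>t = |\<langle>\<psi>\<^sub>0\<^sub>0|\<psi>\<^sub>0\<^sub>1\<rangle>|\<^sup>2\<close>; distinctness of the bases means \<open>0 < t < 1\<close>. It suffices to
  let Alice send the powers \<open>\<psi>\<^sub>i\<^sub>\<beta>\<^sup>\<otimes>\<^sup>k\<close>, whose outcome probabilities are products of \<open>0\<close>, \<open>1\<close>,
  \<open>t\<close> and \<open>1 - t\<close>. The empty pulse gives \<open>S\<^sub>0\<^sub>0\<^sub>0 = S\<^sub>0\<^sub>0\<^sub>1 = s\<close>. Single photons force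
  \<open>\<eta>\<^sub>0 (S\<^sub>1\<^sub>0\<^sub>\<beta> - s)\<close> and \<open>\<eta>\<^sub>1 (S\<^sub>0\<^sub>1\<^sub>\<beta> - s)\<close> to have a common value \<open>c\<close> for both bases. For two photons
  the reports for the counts \<open>(2, 0)\<close> and \<open>(0, 2)\<close> are then \<open>s + (2 - \<eta>\<^sub>0) c\<close> and \<open>s + (2 - \<eta>\<^sub>1) c\<close>,
  and comparing the pulses \<open>\<psi>\<^sub>0\<^sub>0\<^sup>\<otimes>\<^sup>2\<close> and \<open>\<psi>\<^sub>1\<^sub>0\<^sup>\<otimes>\<^sup>2\<close> shows that these agree, so \<open>c = 0\<close>
  because \<open>\<eta>\<^sub>0 \<noteq> \<eta>\<^sub>1\<close>; what remains is \<open>2 t (1 - t) \<eta>\<^sub>0 \<eta>\<^sub>1 (S\<^sub>1\<^sub>1\<^sub>\<beta> - s) = 0\<close>.\<close>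

subsection \<open>Tensor products\<close>

lemma cscalar_prod_sum:
  "u \<bullet>c v = (\<Sum>i<dim_vec v. u $ i * cnj (v $ i))" for u v :: "complex vec"
  by (simp add: scalar_prod_def atLeast0LessThan)

text \<open>Quotient and remainder by \<open>n\<close> identify \<open>{..<m * n}\<close> with pairs
  of indices, block by block; this is the indexing convention of \<open>tensor_vec\<close>.\<close>

lemma sum_div_mod:
  fixes f :: "nat \<Rightarrow> nat \<Rightarrow> 'a :: comm_monoid_add"
  shows "(\<Sum>i<m * n. f (i div n) (i mod n)) = (\<Sum>i<m. \<Sum>j<n. f i j)"
proof -
  have "(\<Sum>i<m * n. f (i div n) (i mod n))
      = (\<Sum>i<m. \<Sum>j\<in>{i * n..<i * n + n}. f (j div n) (j mod n))"
    by (rule sum.nat_group[symmetric])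
  also have "\<dots> = (\<Sum>i<m. \<Sum>j<n. f i j)"
  proof (rule sum.cong[OF refl])
    fix i
    have "(\<Sum>j\<in>{i * n..<i * n + n}. f (j div n) (j mod n))
        = (\<Sum>j\<in>{0..<n}. f ((j + i * n) div n) ((j + i * n) mod n))"
      using sum.shift_bounds_nat_ivl[of "\<lambda>j. f (j div n) (j mod n)" 0 "i * n" n]
      by (simp add: add.commute)
    also have "\<dots> = (\<Sum>j<n. f i j)"
      by (rule sum.cong) auto
    finally show "(\<Sum>j\<in>{i * n..<i * n + n}. f (j div n) (j mod n)) = (\<Sum>j<n. f i j)" .
  qed
  finally show ?thesis .
qed

lemma dim_tensor_vec [simp]: "dim_vec (tensor_vec u v) = dim_vec u * dim_vec v"
  by (simp add: tensor_vec_def)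

lemma tensor_vec_index:
  "i < dim_vec u * dim_vec v \<Longrightarrow>
     tensor_vec u v $ i = u $ (i div dim_vec v) * v $ (i mod dim_vec v)"
  by (simp add: tensor_vec_def)

text \<open>Splitting the index into its two digits turns the sum into a double sum whose terms
  factor.\<close>

lemma cscalar_prod_tensor_vec:
  assumes "dim_vec u = dim_vec u'" "dim_vec v = dim_vec v'"
  shows "tensor_vec u v \<bullet>c tensor_vec u' v' = (u \<bullet>c u') * (v \<bullet>c v')"
proof -
  have "tensor_vec u v \<bullet>c tensor_vec u' v'
      = (\<Sum>i<dim_vec u' * dim_vec v'.
          (u $ (i div dim_vec v') * cnj (u' $ (i div dim_vec v')))
          * (v $ (i mod dim_vec v') * cnj (v' $ (i mod dim_vec v'))))"
    using assms by (simp add: cscalar_prod_sum tensor_vec_index mult_ac)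
  also have "\<dots> = (\<Sum>i<dim_vec u'. \<Sum>j<dim_vec v'.
      (u $ i * cnj (u' $ i)) * (v $ j * cnj (v' $ j)))"
    by (rule sum_div_mod)
  also have "\<dots> = (u \<bullet>c u') * (v \<bullet>c v')"
    by (simp only: cscalar_prod_sum sum_product)
  finally show ?thesis .
qed

lemma tensor_list_Nil [simp]: "tensor_list [] = vec 1 (\<lambda>_. 1)"
  and tensor_list_Cons [simp]: "tensor_list (v # vs) = tensor_vec v (tensor_list vs)"
  by (simp_all add: tensor_list_def)

lemma dim_tensor_list:
  "(\<And>v. v \<in> set vs \<Longrightarrow> dim_vec v = n) \<Longrightarrow> dim_vec (tensor_list vs) = n ^ length vs"
  by (induction vs) auto

lemma cscalar_prod_tensor_list:
  assumes "length us = length vs"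
    and "\<And>u. u \<in> set us \<Longrightarrow> dim_vec u = n" "\<And>v. v \<in> set vs \<Longrightarrow> dim_vec v = n"
  shows "tensor_list us \<bullet>c tensor_list vs = (\<Prod>(u, v)\<leftarrow>zip us vs. u \<bullet>c v)"
  using assms
proof (induction us vs rule: list_induct2)
  case Nil
  then show ?case by (simp add: cscalar_prod_sum)
next
  case (Cons u us v vs)
  have "dim_vec (tensor_list us) = dim_vec (tensor_list vs)"
    using Cons.hyps Cons.prems by (simp add: dim_tensor_list[of _ n])
  then show ?case
    using Cons by (simp add: cscalar_prod_tensor_vec)
qed

subsection \<open>Orthonormal bases\<close>

text \<open>Let \<open>A\<close> have the basis vectors as rows and let \<open>B\<close> be its
  adjoint. Orthonormality is \<open>A * B = 1\<close>; for square matrices this implies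
  \<open>B * A = 1\<close>, whose entries are the completeness relation.\<close>

lemma orthonormal_basis_completeness:
  assumes "orthonormal_basis n vs" "length vs = n" "i < n" "j < n"
  shows "(\<Sum>l<n. vs ! l $ i * cnj (vs ! l $ j)) = (if i = j then 1 else 0)"
proof -
  define A where "A = mat n n (\<lambda>(l, m). vs ! l $ m)"
  define B where "B = mat n n (\<lambda>(m, l). cnj (vs ! l $ m))"
  have A: "A \<in> carrier_mat n n" and B: "B \<in> carrier_mat n n"
    by (auto simp: A_def B_def)
  have dim: "dim_vec (vs ! l) = n" if "l < n" for l
  proof -
    have "vs ! l \<in> carrier_vec n"
      using assms(1,2) that nth_mem[of l vs] unfolding orthonormal_basis_def by blast
    then show ?thesis by simp
  qed
  have orth: "(\<Sum>m<n. vs ! l $ m * cnj (vs ! l' $ m)) = (if l = l' then 1 else 0)"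
    if "l < n" "l' < n" for l l'
    using assms(1,2) that dim by (simp add: orthonormal_basis_def cscalar_prod_sum)
  have "A * B = 1\<^sub>m n"
    by (rule eq_matI)
      (auto simp: A_def B_def scalar_prod_def atLeast0LessThan orth)
  then have "B * A = 1\<^sub>m n"
    by (rule mat_mult_left_right_inverse[OF A B])
  then have "(B * A) $$ (j, i) = (if i = j then 1 else 0)"
    using assms by auto
  moreover have "(B * A) $$ (j, i) = (\<Sum>l<n. cnj (vs ! l $ j) * vs ! l $ i)"
    using assms by (simp add: A_def B_def scalar_prod_def atLeast0LessThan)
  ultimately show ?thesis
    by (simp add: mult.commute)
qed

lemma cscalar_prod_commute:
  "dim_vec u = dim_vec v \<Longrightarrow> v \<bullet>c u = cnj (u \<bullet>c v)" for u v :: "complex vec"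
  by (simp add: cscalar_prod_sum mult.commute)

lemma cmod_cscalar_prod_commute:
  "dim_vec u = dim_vec v \<Longrightarrow> cmod (v \<bullet>c u) = cmod (u \<bullet>c v)"
  by (simp add: cscalar_prod_commute[of u v])

section \<open>Expansion and Parseval identity in a qubit basis\<close>

context
  fixes a b :: "complex vec"
  assumes ab: "orthonormal_basis 2 [a, b]"
begin

lemma qubit_basis_dim: "dim_vec a = 2" "dim_vec b = 2"
  using ab by (auto simp: orthonormal_basis_def)

lemma qubit_basis_inner: "a \<bullet>c a = 1" "b \<bullet>c b = 1" "a \<bullet>c b = 0" "b \<bullet>c a = 0"
  using ab by (auto simp: orthonormal_basis_def less_Suc_eq numeral_2_eq_2)

lemma qubit_basis_completeness:
  "i < 2 \<Longrightarrow> j < 2 \<Longrightarrow> a $ i * cnj (a $ j) + b $ i * cnj (b $ j) = (if i = j then 1 else 0)"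
  using orthonormal_basis_completeness[OF ab, of i j] by (simp add: numeral_2_eq_2)

lemma qubit_expansion:
  assumes "dim_vec v = 2"
  shows "v = (v \<bullet>c a) \<cdot>\<^sub>v a + (v \<bullet>c b) \<cdot>\<^sub>v b"
proof (rule eq_vecI)
  fix i assume "i < dim_vec ((v \<bullet>c a) \<cdot>\<^sub>v a + (v \<bullet>c b) \<cdot>\<^sub>v b)"
  then have i: "i < 2" by (simp add: qubit_basis_dim)
  \<comment> \<open>Writing the coefficients out as sums over \<open>j\<close> exposes the
    completeness relation, which acts as a Kronecker delta on \<open>v\<close>.\<close>
  have "((v \<bullet>c a) \<cdot>\<^sub>v a + (v \<bullet>c b) \<cdot>\<^sub>v b) $ i
      = (\<Sum>j<2. v $ j * (a $ i * cnj (a $ j) + b $ i * cnj (b $ j)))"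
    using i by (simp add: cscalar_prod_sum qubit_basis_dim numeral_2_eq_2 algebra_simps)
  also have "\<dots> = (\<Sum>j<2. v $ j * (if i = j then 1 else 0))"
    using i by (intro sum.cong) (auto simp: qubit_basis_completeness)
  also have "\<dots> = v $ i"
    using i by (simp add: if_distrib cong: if_cong)
  finally show "v $ i = ((v \<bullet>c a) \<cdot>\<^sub>v a + (v \<bullet>c b) \<cdot>\<^sub>v b) $ i" ..
qed (use assms in \<open>simp add: qubit_basis_dim\<close>)

lemma qubit_parseval:
  assumes "dim_vec v = 2" "v \<bullet>c v = 1"
  shows "(cmod (v \<bullet>c a))\<^sup>2 + (cmod (v \<bullet>c b))\<^sup>2 = 1"
proof -
  define x y where "x = v \<bullet>c a" and "y = v \<bullet>c b"
  have v: "v $ i = x * a $ i + y * b $ i" if "i < 2" for i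
    using arg_cong[OF qubit_expansion[OF assms(1)], of "\<lambda>w. w $ i"] that
    by (simp add: qubit_basis_dim x_def y_def)
  \<comment> \<open>Only the conjugated factor is expanded, so the remaining sums are again the
    coefficients of \<open>v\<close>.\<close>
  have "v \<bullet>c v = (\<Sum>i<2. v $ i * cnj (x * a $ i + y * b $ i))"
    unfolding cscalar_prod_sum assms(1) by (intro sum.cong refl) (simp add: v)
  also have "\<dots> = cnj x * (v \<bullet>c a) + cnj y * (v \<bullet>c b)"
    by (simp add: cscalar_prod_sum qubit_basis_dim sum_distrib_left sum.distrib algebra_simps)
  finally have "complex_of_real ((cmod (v \<bullet>c a))\<^sup>2 + (cmod (v \<bullet>c b))\<^sup>2) = of_real 1"
    using assms(2)
    by (simp only: of_real_add complex_norm_square of_real_1 x_def y_def mult.commute)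
  then show ?thesis
    by (simp only: of_real_eq_iff)
qed

end

section \<open>Overlaps between two distinct qubit bases\<close>

lemma ray_smult:
  assumes "cmod z = 1"
  shows "ray (z \<cdot>\<^sub>v v) = ray v"
proof
  have "c \<cdot>\<^sub>v (z \<cdot>\<^sub>v v) = (c * z) \<cdot>\<^sub>v v \<and> cmod (c * z) = 1" if "cmod c = 1" for c
    using assms that by (simp add: smult_smult_assoc norm_mult)
  then show "ray (z \<cdot>\<^sub>v v) \<subseteq> ray v"
    unfolding ray_def by blast
  have "z \<noteq> 0"
    using assms by auto
  then have "c \<cdot>\<^sub>v v = (c / z) \<cdot>\<^sub>v (z \<cdot>\<^sub>v v) \<and> cmod (c / z) = 1" if "cmod c = 1" for c
    using assms that by (simp add: smult_smult_assoc norm_divide)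
  then show "ray v \<subseteq> ray (z \<cdot>\<^sub>v v)"
    unfolding ray_def by blast
qed

text \<open>One of the two expansion coefficients vanishes, and by Parseval the other has modulus 1,
  so it is a phase.\<close>

lemma ray_eq_if_orthogonal:
  assumes ab: "orthonormal_basis 2 [a, b]" and v: "dim_vec v = 2" "v \<bullet>c v = 1"
  shows "v \<bullet>c b = 0 \<Longrightarrow> ray v = ray a" and "v \<bullet>c a = 0 \<Longrightarrow> ray v = ray b"
proof -
  note dim = qubit_basis_dim[OF ab] and parseval = qubit_parseval[OF ab v]
  note expansion = arg_cong[OF qubit_expansion[OF ab v(1)], of "\<lambda>w. w $ i" for i]
  show "ray v = ray a" if "v \<bullet>c b = 0"
  proof -
    have "v = (v \<bullet>c a) \<cdot>\<^sub>v a"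
      by (rule eq_vecI) (use expansion that v(1) dim in auto)
    moreover have "cmod (v \<bullet>c a) = 1"
      using parseval that by (simp add: abs_square_eq_1)
    ultimately show ?thesis
      using ray_smult by metis
  qed
  show "ray v = ray b" if "v \<bullet>c a = 0"
  proof -
    have "v = (v \<bullet>c b) \<cdot>\<^sub>v b"
      by (rule eq_vecI) (use expansion that v(1) dim in auto)
    moreover have "cmod (v \<bullet>c b) = 1"
      using parseval that by (simp add: abs_square_eq_1)
    ultimately show ?thesis
      using ray_smult by metis
  qed
qed

text \<open>The squared overlaps form a doubly stochastic 2 by 2 matrix, so one entry determines the
  others. The values 0 and 1 of that entry would make the two bases agree up to phases, in swapped
  or in the same order.\<close>

lemma distinct_bases_overlap:
  assumes ab: "orthonormal_basis 2 [a, b]" and cd: "orthonormal_basis 2 [c, d]"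
    and "distinct_bases {a, b} {c, d}"
  shows "0 < (cmod (c \<bullet>c a))\<^sup>2" "(cmod (c \<bullet>c a))\<^sup>2 < 1"
    and "(cmod (c \<bullet>c b))\<^sup>2 = 1 - (cmod (c \<bullet>c a))\<^sup>2"
    and "(cmod (d \<bullet>c a))\<^sup>2 = 1 - (cmod (c \<bullet>c a))\<^sup>2"
    and "(cmod (d \<bullet>c b))\<^sup>2 = (cmod (c \<bullet>c a))\<^sup>2"
proof -
  note dims = qubit_basis_dim[OF ab] qubit_basis_dim[OF cd]
  note inner = qubit_basis_inner[OF ab] qubit_basis_inner[OF cd]
  \<comment> \<open>The row sums come from expanding \<open>c\<close> and \<open>d\<close> in the
    first basis, the column sum from expanding \<open>a\<close> in the second.\<close>
  have c: "(cmod (c \<bullet>c a))\<^sup>2 + (cmod (c \<bullet>c b))\<^sup>2 = 1"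
    and d: "(cmod (d \<bullet>c a))\<^sup>2 + (cmod (d \<bullet>c b))\<^sup>2 = 1"
    and a: "(cmod (c \<bullet>c a))\<^sup>2 + (cmod (d \<bullet>c a))\<^sup>2 = 1"
    using qubit_parseval[OF ab, of c] qubit_parseval[OF ab, of d] qubit_parseval[OF cd, of a]
      cmod_cscalar_prod_commute[of a c] cmod_cscalar_prod_commute[of a d]
    by (simp_all add: dims inner)
  show cb: "(cmod (c \<bullet>c b))\<^sup>2 = 1 - (cmod (c \<bullet>c a))\<^sup>2"
    using c by linarith
  show da: "(cmod (d \<bullet>c a))\<^sup>2 = 1 - (cmod (c \<bullet>c a))\<^sup>2"
    using a by linarith
  show db: "(cmod (d \<bullet>c b))\<^sup>2 = (cmod (c \<bullet>c a))\<^sup>2"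
    using d da by linarith
  have "(cmod (c \<bullet>c a))\<^sup>2 \<noteq> 0"
  proof
    assume t: "(cmod (c \<bullet>c a))\<^sup>2 = 0"
    have "ray c = ray b" "ray d = ray a"
      using ray_eq_if_orthogonal[OF ab, of c] ray_eq_if_orthogonal[OF ab, of d] t db
      by (simp_all only: dims inner) simp_all
    then show False
      using assms(3) by (auto simp: distinct_bases_def)
  qed
  then show "0 < (cmod (c \<bullet>c a))\<^sup>2" by simp
  have "(cmod (c \<bullet>c a))\<^sup>2 \<noteq> 1"
  proof
    assume t: "(cmod (c \<bullet>c a))\<^sup>2 = 1"
    have "ray c = ray a" "ray d = ray b"
      using ray_eq_if_orthogonal[OF ab, of c] ray_eq_if_orthogonal[OF ab, of d] t cb da
      by (simp_all only: dims inner) simp_all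
    then show False
      using assms(3) by (auto simp: distinct_bases_def)
  qed
  moreover have "(cmod (c \<bullet>c a))\<^sup>2 \<le> 1"
    using c zero_le_power2[of "cmod (c \<bullet>c b)"] by linarith
  ultimately show "(cmod (c \<bullet>c a))\<^sup>2 < 1" by simp
qed

subsection \<open>Pure states\<close>

text \<open>The rank-one operator \<open>|v><v|\<close>.\<close>

definition pure_state :: "complex vec \<Rightarrow> complex mat" where
  "pure_state v = mat (dim_vec v) (dim_vec v) (\<lambda>(i, j). v $ i * cnj (v $ j))"

lemma pure_state_cscalar_prod:
  assumes "dim_vec u = dim_vec v" "dim_vec w = dim_vec v"
  shows "(pure_state v *\<^sub>v w) \<bullet>c u = (w \<bullet>c v) * (v \<bullet>c u)"
proof -
  have "(pure_state v *\<^sub>v w) $ i = (w \<bullet>c v) * v $ i" if "i < dim_vec v" for i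
    using that assms
    by (simp add: pure_state_def scalar_prod_def atLeast0LessThan sum_distrib_left mult_ac)
  then show ?thesis
    using assms by (simp add: cscalar_prod_sum[of _ u] sum_distrib_left mult.assoc)
qed

lemma pure_state_expectation:
  assumes "dim_vec w = dim_vec v"
  shows "(pure_state v *\<^sub>v w) \<bullet>c w = of_real ((cmod (v \<bullet>c w))\<^sup>2)"
  using assms
  by (simp add: pure_state_cscalar_prod cscalar_prod_commute[of v w] complex_norm_square
      mult.commute del: of_real_power)

lemma qubit_state_pure_state:
  assumes "dim_vec v = 2 ^ k" "v \<bullet>c v = 1"
  shows "qubit_state k (pure_state v)"
proof -
  have "mat_adjoint (pure_state v) = pure_state v"
    by (rule eq_matI) (auto simp: mat_adjoint_def mat_of_rows_def pure_state_def)
  moreover have "0 \<le> (pure_state v *\<^sub>v w) \<bullet>c w" if "w \<in> carrier_vec (2 ^ k)" for w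
    using that assms by (subst pure_state_expectation) (auto simp: less_eq_complex_def)
  moreover have "(\<Sum>i<2 ^ k. pure_state v $$ (i, i)) = 1"
    using assms by (simp add: pure_state_def cscalar_prod_sum)
  ultimately show ?thesis
    using assms by (auto simp: qubit_state_def pure_state_def)
qed

subsection \<open>Report probabilities as sums over outcome strings\<close>

text \<open>The conjuncts are ordered as in \<open>finite_lists_length_eq\<close> and
  \<open>lists_length_Suc_eq\<close>, so that these apply directly.\<close>

definition bit_lists :: "nat \<Rightarrow> nat list set" where
  "bit_lists k = {x. set x \<subseteq> {0, 1} \<and> length x = k}"

lemma finite_bit_lists [simp]: "finite (bit_lists k)"
  by (simp add: bit_lists_def finite_lists_length_eq)

lemma bit_lists_0 [simp]: "bit_lists 0 = {[]}"
  by (auto simp: bit_lists_def)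

lemma sum_bit_lists_Suc:
  "(\<Sum>x\<in>bit_lists (Suc k). f x) = (\<Sum>x\<in>bit_lists k. f (0 # x)) + (\<Sum>x\<in>bit_lists k. f (1 # x))"
proof -
  have "(\<Sum>x\<in>bit_lists (Suc k). f x) = (\<Sum>(x, i)\<in>bit_lists k \<times> {0, 1}. f (i # x))"
    unfolding bit_lists_def lists_length_Suc_eq
    by (subst sum.reindex) (auto simp: inj_on_def case_prod_unfold)
  also have "\<dots> = (\<Sum>x\<in>bit_lists k. f (0 # x)) + (\<Sum>x\<in>bit_lists k. f (1 # x))"
    by (simp add: sum.distrib flip: sum.cartesian_product)
  finally show ?thesis .
qed

definition outcome_prob ::
    "(nat \<Rightarrow> nat \<Rightarrow> complex vec) \<Rightarrow> nat \<Rightarrow> complex mat \<Rightarrow> nat list \<Rightarrow> real" where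
  "outcome_prob \<psi> \<beta> \<rho> x =
     (let \<psi>x = tensor_list (map (\<lambda>i. \<psi> i \<beta>) x) in Re ((\<rho> *\<^sub>v \<psi>x) \<bullet>c \<psi>x))"

text \<open>The conditional probability of \<open>m = 1\<close> given that \<open>k0\<close> and
  \<open>k1\<close> photons reach the detectors. It depends neither on the state nor on the basis
  vectors.\<close>

definition count_report ::
    "(nat \<Rightarrow> nat \<Rightarrow> real) \<Rightarrow> (nat \<Rightarrow> nat \<Rightarrow> real) \<Rightarrow> (nat \<Rightarrow> nat \<Rightarrow> nat \<Rightarrow> real) \<Rightarrow>
     nat \<Rightarrow> nat \<Rightarrow> nat \<Rightarrow> real" where
  "count_report \<eta> d S \<beta> k0 k1 =
     (\<Sum>c0 \<in> {0, 1}. \<Sum>c1 \<in> {0, 1}. S c0 c1 \<beta> *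
        (click_prob (\<eta> 0 \<beta>) (d 0 \<beta>) k0 c0 * click_prob (\<eta> 1 \<beta>) (d 1 \<beta>) k1 c1))"

text \<open>The photon count distribution groups outcome strings by their number of zeros. Undoing
  this grouping leaves a single sum over strings, which is easier to evaluate and to
  normalize.\<close>

lemma P_report_eq_sum:
  "P_report \<psi> \<eta> d S \<beta> \<rho> k =
     (\<Sum>x\<in>bit_lists k. outcome_prob \<psi> \<beta> \<rho> x *
        count_report \<eta> d S \<beta> (count_list x 0) (k - count_list x 0))"
proof -
  have zeros: "card {j. j < length x \<and> x ! j = 0} = count_list x 0" for x :: "nat list"
    by (simp add: count_list_eq_length_filter length_filter_conv_card eq_commute[of 0])
  have count: "photon_count_prob \<psi> k0 \<beta> \<rho> k =
      (\<Sum>x\<in>{x \<in> bit_lists k. count_list x 0 = k0}. outcome_prob \<psi> \<beta> \<rho> x)" for k0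
    unfolding photon_count_prob_def outcome_prob_def
    by (rule sum.cong) (auto simp: bit_lists_def zeros)
  have "P_report \<psi> \<eta> d S \<beta> \<rho> k =
      (\<Sum>k0\<le>k. photon_count_prob \<psi> k0 \<beta> \<rho> k * count_report \<eta> d S \<beta> k0 (k - k0))"
    by (simp add: P_report_def P_det_def count_report_def sum_distrib_left sum.distrib
        algebra_simps)
  also have "\<dots> = (\<Sum>k0\<le>k. \<Sum>x\<in>{x \<in> bit_lists k. count_list x 0 = k0}. outcome_prob \<psi> \<beta> \<rho> x *
        count_report \<eta> d S \<beta> (count_list x 0) (k - count_list x 0))"
    by (simp add: count sum_distrib_right)
  also have "\<dots> = (\<Sum>x\<in>bit_lists k. outcome_prob \<psi> \<beta> \<rho> x *
        count_report \<eta> d S \<beta> (count_list x 0) (k - count_list x 0))"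
    by (rule sum.group[OF finite_bit_lists]) (auto simp: bit_lists_def count_le_length)
  finally show ?thesis .
qed

section \<open>Total probability of the outcome strings\<close>

lemma tensor_basis_completeness:
  assumes ab: "orthonormal_basis 2 [\<phi> 0, \<phi> 1]" and "m < 2 ^ k" "n < 2 ^ k"
  shows "(\<Sum>x\<in>bit_lists k. tensor_list (map \<phi> x) $ m * cnj (tensor_list (map \<phi> x) $ n))
       = (if m = n then 1 else 0)"
  using assms(2,3)
proof (induction k arbitrary: m n)
  case 0
  then show ?case by simp
next
  case (Suc k)
  let ?m1 = "m div 2 ^ k" and ?m2 = "m mod 2 ^ k" and ?n1 = "n div 2 ^ k" and ?n2 = "n mod 2 ^ k"
  let ?T = "\<lambda>x. tensor_list (map \<phi> x)"
  have bounds: "?m1 < 2" "?n1 < 2" "?m2 < 2 ^ k" "?n2 < 2 ^ k"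
    using Suc.prems by (simp_all add: less_mult_imp_div_less)
  have T: "?T (i # x) $ l = \<phi> i $ (l div 2 ^ k) * ?T x $ (l mod 2 ^ k)"
    if "i \<in> {0, 1}" "x \<in> bit_lists k" "l < 2 ^ Suc k" for i x l
  proof -
    have dim: "dim_vec (\<phi> j) = 2" if "j \<in> {0, 1}" for j
      using that qubit_basis_dim[OF ab] by auto
    have "dim_vec (?T x) = 2 ^ k"
      using that(2) dim by (subst dim_tensor_list[of _ 2]) (auto simp: bit_lists_def)
    then show ?thesis
      using that dim[OF that(1)] by (simp add: tensor_vec_index)
  qed
  \<comment> \<open>The first outcome governs the leading binary digit of the indices, so the sum
    over it splits off as a one-qubit completeness relation; the rest is the induction hypothesis
    for the lower digits.\<close>
  have "(\<Sum>x\<in>bit_lists (Suc k). ?T x $ m * cnj (?T x $ n))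
      = (\<phi> 0 $ ?m1 * cnj (\<phi> 0 $ ?n1) + \<phi> 1 $ ?m1 * cnj (\<phi> 1 $ ?n1))
        * (\<Sum>x\<in>bit_lists k. ?T x $ ?m2 * cnj (?T x $ ?n2))"
    using Suc.prems
    by (simp add: sum_bit_lists_Suc T sum_distrib_left distrib_left distrib_right mult_ac
        del: list.map tensor_list_Cons)
  also have "\<dots> = (if ?m1 = ?n1 then 1 else 0) * (if ?m2 = ?n2 then 1 else 0)"
    by (simp only: Suc.IH[OF bounds(3,4)] qubit_basis_completeness[OF ab bounds(1,2)])
  also have "\<dots> = (if m = n then 1 else 0)"
  proof -
    have "m = n \<longleftrightarrow> ?m1 = ?n1 \<and> ?m2 = ?n2"
      by (metis div_mult_mod_eq)
    then show ?thesis by simp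
  qed
  finally show ?case .
qed

text \<open>By completeness of the product basis, the sum of the diagonal elements of
  \<open>\<rho>\<close> in that basis is its trace. This holds for arbitrary states, as the converse
  direction of the theorem requires.\<close>

lemma sum_outcome_prob:
  assumes ab: "orthonormal_basis 2 [\<psi> 0 \<beta>, \<psi> 1 \<beta>]" and \<rho>: "qubit_state k \<rho>"
  shows "(\<Sum>x\<in>bit_lists k. outcome_prob \<psi> \<beta> \<rho> x) = 1"
proof -
  let ?T = "\<lambda>x. tensor_list (map (\<lambda>i. \<psi> i \<beta>) x)"
  have \<rho>_dim: "dim_row \<rho> = 2 ^ k" "dim_col \<rho> = 2 ^ k"
    using \<rho> by (auto simp: qubit_state_def)
  have T: "dim_vec (?T x) = 2 ^ k" if "x \<in> bit_lists k" for x
    using that qubit_basis_dim[OF ab] by (subst dim_tensor_list[of _ 2]) (auto simp: bit_lists_def)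
  have "(\<Sum>x\<in>bit_lists k. (\<rho> *\<^sub>v ?T x) \<bullet>c ?T x)
      = (\<Sum>x\<in>bit_lists k. \<Sum>m<2 ^ k. \<Sum>n<2 ^ k. \<rho> $$ (m, n) * (?T x $ n * cnj (?T x $ m)))"
    using T \<rho>_dim
    by (simp add: cscalar_prod_sum scalar_prod_def atLeast0LessThan sum_distrib_right mult.assoc)
  also have "\<dots> = (\<Sum>m<2 ^ k. \<Sum>n<2 ^ k. \<rho> $$ (m, n) *
      (\<Sum>x\<in>bit_lists k. ?T x $ n * cnj (?T x $ m)))"
    unfolding sum_distrib_left
    \<comment> \<open>Two exchanges move the sum over strings to the innermost position.\<close>
    by (subst sum.swap, rule sum.cong[OF refl], subst sum.swap, rule refl)
  also have "\<dots> = (\<Sum>m<2 ^ k. \<Sum>n<2 ^ k. if m = n then \<rho> $$ (m, n) else 0)"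
    by (intro sum.cong refl) (simp add: tensor_basis_completeness[of "\<lambda>i. \<psi> i \<beta>", OF ab])
  also have "\<dots> = 1"
    using \<rho> by (simp add: qubit_state_def)
  finally have "Re (\<Sum>x\<in>bit_lists k. (\<rho> *\<^sub>v ?T x) \<bullet>c ?T x) = 1"
    by simp
  then show ?thesis
    by (simp add: outcome_prob_def Let_def)
qed

text \<open>For each detector the probabilities of click and no click add up to 1.\<close>

lemma count_report_const:
  assumes "\<forall>c0 \<in> {0, 1}. \<forall>c1 \<in> {0, 1}. S c0 c1 \<beta> = s"
  shows "count_report \<eta> d S \<beta> k0 k1 = s"
  using assms by (simp add: count_report_def click_prob_def Let_def algebra_simps)

section \<open>Tensor powers as probe pulses\<close>

lemma outcome_prob_tensor_power:
  assumes "dim_vec v = 2" "\<forall>i \<in> {0, 1}. dim_vec (\<psi> i \<beta>) = 2" "x \<in> bit_lists k"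
  shows "outcome_prob \<psi> \<beta> (pure_state (tensor_list (replicate k v))) x
       = (\<Prod>i\<leftarrow>x. (cmod (v \<bullet>c \<psi> i \<beta>))\<^sup>2)"
proof -
  let ?us = "replicate k v" and ?vs = "map (\<lambda>i. \<psi> i \<beta>) x"
  have len: "length x = k"
    using assms(3) by (simp add: bit_lists_def)
  have us: "dim_vec u = 2" if "u \<in> set ?us" for u
    using that assms(1) by (simp split: if_splits)
  have vs: "dim_vec w = 2" if "w \<in> set ?vs" for w
    using that assms(2,3) by (auto simp: bit_lists_def)
  have "zip ?us ?vs = map (\<lambda>i. (v, \<psi> i \<beta>)) x"
    unfolding len[symmetric] by (induction x) simp_all
  \<comment> \<open>Both vectors are products, so their overlap is the product of the one-photon
    overlaps.\<close>
  then have inner: "tensor_list ?us \<bullet>c tensor_list ?vs = (\<Prod>i\<leftarrow>x. v \<bullet>c \<psi> i \<beta>)"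
    using cscalar_prod_tensor_list[of ?us ?vs, OF _ us vs] len by (simp add: comp_def)
  have "dim_vec (tensor_list ?us) = 2 ^ k"
    using dim_tensor_list[of ?us, OF us] by simp
  moreover have "dim_vec (tensor_list ?vs) = 2 ^ k"
    using dim_tensor_list[of ?vs, OF vs] len by simp
  moreover have "(cmod (\<Prod>i\<leftarrow>x. v \<bullet>c \<psi> i \<beta>))\<^sup>2 = (\<Prod>i\<leftarrow>x. (cmod (v \<bullet>c \<psi> i \<beta>))\<^sup>2)"
    by (induction x) (simp_all add: norm_mult power_mult_distrib)
  ultimately show ?thesis
    by (simp add: outcome_prob_def Let_def pure_state_expectation inner del: of_real_power)
qed

lemma qubit_state_tensor_power:
  assumes "dim_vec v = 2" "v \<bullet>c v = 1"
  shows "qubit_state k (pure_state (tensor_list (replicate k v)))"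
proof (rule qubit_state_pure_state)
  show "dim_vec (tensor_list (replicate k v)) = 2 ^ k"
    using assms by (subst dim_tensor_list[of _ 2]) auto
  have "tensor_list (replicate k v) \<bullet>c tensor_list (replicate k v)
      = (\<Prod>(u, w)\<leftarrow>zip (replicate k v) (replicate k v). u \<bullet>c w)"
    using assms by (intro cscalar_prod_tensor_list[of _ _ 2]) auto
  also have "\<dots> = 1"
    using assms by (induction k) auto
  finally show "tensor_list (replicate k v) \<bullet>c tensor_list (replicate k v) = 1" .
qed

lemma P_report_tensor_power:
  assumes "dim_vec v = 2" "\<forall>i \<in> {0, 1}. dim_vec (\<psi> i \<beta>) = 2"
  shows "P_report \<psi> \<eta> d S \<beta> (pure_state (tensor_list (replicate k v))) k =
     (\<Sum>x\<in>bit_lists k. (\<Prod>i\<leftarrow>x. (cmod (v \<bullet>c \<psi> i \<beta>))\<^sup>2) *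
        count_report \<eta> d S \<beta> (count_list x 0) (k - count_list x 0))"
  using assms by (simp add: P_report_eq_sum outcome_prob_tensor_power)

theorem theorem1:
  fixes \<psi> :: "nat \<Rightarrow> nat \<Rightarrow> complex vec"
    and \<eta> d :: "nat \<Rightarrow> nat \<Rightarrow> real"
    and e :: "nat \<Rightarrow> real"
    and S :: "nat \<Rightarrow> nat \<Rightarrow> nat \<Rightarrow> real"
  assumes "\<forall>\<beta> \<in> {0, 1}. orthonormal_basis 2 [\<psi> 0 \<beta>, \<psi> 1 \<beta>]"
    and "distinct_bases {\<psi> 0 0, \<psi> 1 0} {\<psi> 0 1, \<psi> 1 1}"
    and "\<forall>i \<in> {0, 1}. \<forall>\<beta> \<in> {0, 1}. d i \<beta> = 0"
    and "\<forall>i \<in> {0, 1}. \<forall>\<beta> \<in> {0, 1}. \<eta> i \<beta> = e i"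
    and "\<forall>i \<in> {0, 1}. e i \<in> {0<..<1}"
    and "e 0 \<noteq> e 1"
    and "reporting_strategy S"
    and "\<exists>c0 \<in> {0, 1}. \<exists>c1 \<in> {0, 1}. \<exists>\<beta> \<in> {0, 1}. S c0 c1 \<beta> \<noteq> 0"
  shows "(\<forall>k \<in> {0, 1, 2}. \<forall>\<rho>. qubit_state k \<rho> \<longrightarrow>
            P_report \<psi> \<eta> d S 1 \<rho> k = P_report \<psi> \<eta> d S 0 \<rho> k)
         \<longleftrightarrow> trivial_strategy S"
proof
  \<comment> \<open>Keeps the bit 1 from being rewritten to \<open>Suc 0\<close>, so that facts
    about \<open>R 1\<close>, \<open>a 1\<close> and the like still match.\<close>
  note One_nat_def [simp del]
  have onb: "orthonormal_basis 2 [\<psi> 0 0, \<psi> 1 0]" "orthonormal_basis 2 [\<psi> 0 1, \<psi> 1 1]"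
    using assms(1) by simp_all
  assume indist: "\<forall>k \<in> {0, 1, 2}. \<forall>\<rho>. qubit_state k \<rho> \<longrightarrow>
      P_report \<psi> \<eta> d S 1 \<rho> k = P_report \<psi> \<eta> d S 0 \<rho> k"
  define t where "t = (cmod (\<psi> 0 1 \<bullet>c \<psi> 0 0))\<^sup>2"
  note dims = qubit_basis_dim[OF onb(1)] qubit_basis_dim[OF onb(2)]
  note inner = qubit_basis_inner[OF onb(1)] qubit_basis_inner[OF onb(2)]
  note overlap = distinct_bases_overlap[OF onb assms(2), folded t_def]
  have overlap': "(cmod (\<psi> 0 0 \<bullet>c \<psi> 0 1))\<^sup>2 = t" "(cmod (\<psi> 0 0 \<bullet>c \<psi> 1 1))\<^sup>2 = 1 - t"
    "(cmod (\<psi> 1 0 \<bullet>c \<psi> 0 1))\<^sup>2 = 1 - t" "(cmod (\<psi> 1 0 \<bullet>c \<psi> 1 1))\<^sup>2 = t"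
    using overlap(3-5) t_def
      cmod_cscalar_prod_commute[of "\<psi> 0 0" "\<psi> 0 1"]
      cmod_cscalar_prod_commute[of "\<psi> 0 0" "\<psi> 1 1"]
      cmod_cscalar_prod_commute[of "\<psi> 1 0" "\<psi> 0 1"]
      cmod_cscalar_prod_commute[of "\<psi> 1 0" "\<psi> 1 1"]
    by (simp_all add: dims)
  define R where "R \<beta> = count_report \<eta> d S \<beta>" for \<beta>
  \<comment> \<open>Indistinguishability is tested on the pulses of \<open>k\<close> photons that
    are all in the basis state \<open>\<psi> j \<gamma>\<close>.\<close>
  have report: "(\<Sum>x\<in>bit_lists k. (\<Prod>i\<leftarrow>x. (cmod (\<psi> j \<gamma> \<bullet>c \<psi> i 1))\<^sup>2) *
          R 1 (count_list x 0) (k - count_list x 0))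
      = (\<Sum>x\<in>bit_lists k. (\<Prod>i\<leftarrow>x. (cmod (\<psi> j \<gamma> \<bullet>c \<psi> i 0))\<^sup>2) *
          R 0 (count_list x 0) (k - count_list x 0))"
    if "k \<in> {0, 1, 2}" "j \<in> {0, 1}" "\<gamma> \<in> {0, 1}" for k j \<gamma>
  proof -
    have v: "dim_vec (\<psi> j \<gamma>) = 2" "\<psi> j \<gamma> \<bullet>c \<psi> j \<gamma> = 1"
      using that dims inner by auto
    have "\<forall>i \<in> {0, 1}. dim_vec (\<psi> i 0) = 2" "\<forall>i \<in> {0, 1}. dim_vec (\<psi> i 1) = 2"
      using dims by auto
    moreover have "P_report \<psi> \<eta> d S 1 (pure_state (tensor_list (replicate k (\<psi> j \<gamma>)))) k
        = P_report \<psi> \<eta> d S 0 (pure_state (tensor_list (replicate k (\<psi> j \<gamma>)))) k"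
      using indist that(1) qubit_state_tensor_power[OF v, of k] by blast
    ultimately show ?thesis
      using v(1) by (simp only: R_def P_report_tensor_power)
  qed
  have bits: "(\<Sum>x\<in>bit_lists 1. f x) = f [0] + f [1]"
    "(\<Sum>x\<in>bit_lists 2. f x) = f [0, 0] + f [0, 1] + (f [1, 0] + f [1, 1])"
    for f :: "nat list \<Rightarrow> real"
    by (simp_all add: sum_bit_lists_Suc numeral_2_eq_2 One_nat_def)
  define s where "s = S 0 0 0"
  define e0 e1 where "e0 = e 0" and "e1 = e 1"
  have e: "0 < e0" "e0 < 1" "0 < e1" "e1 < 1" "e0 \<noteq> e1"
    using assms(5,6) by (auto simp: e0_def e1_def)
  have R: "R \<beta> k0 k1 =
      S 0 0 \<beta> * ((1 - e0) ^ k0 * (1 - e1) ^ k1)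
      + S 0 1 \<beta> * ((1 - e0) ^ k0 * (1 - (1 - e1) ^ k1))
      + (S 1 0 \<beta> * ((1 - (1 - e0) ^ k0) * (1 - e1) ^ k1)
      + S 1 1 \<beta> * ((1 - (1 - e0) ^ k0) * (1 - (1 - e1) ^ k1)))"
    if "\<beta> \<in> {0, 1}" for \<beta> k0 k1
    using that assms(3,4)
    by (auto simp: R_def count_report_def click_prob_def e0_def e1_def)
  \<comment> \<open>For \<open>k = 0\<close> there are no dark counts, so neither detector clicks
    and the report probability is \<open>S 0 0 \<beta>\<close>.\<close>
  have s: "S 0 0 0 = s" "S 0 0 1 = s"
    using report[of 0 0 0] by (simp_all add: s_def R)
  \<comment> \<open>These are the changes of the report probability, relative to the empty pulse,
    when one photon reaches the first or the second detector.\<close>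
  define a b where "a \<beta> = e0 * (S 1 0 \<beta> - s)" and "b \<beta> = e1 * (S 0 1 \<beta> - s)" for \<beta>
  have R1: "R \<beta> 1 0 = s + a \<beta>" "R \<beta> 0 1 = s + b \<beta>" if "\<beta> \<in> {0, 1}" for \<beta>
    using that s by (auto simp: R a_def b_def algebra_simps)
  have "t * (s + a 1) + (1 - t) * (s + b 1) = s + a 0"
    "(1 - t) * (s + a 1) + t * (s + b 1) = s + b 0"
    "t * (s + a 0) + (1 - t) * (s + b 0) = s + a 1"
    "(1 - t) * (s + a 0) + t * (s + b 0) = s + b 1"
    using report[of 1 0 0] report[of 1 1 0] report[of 1 0 1] report[of 1 1 1]
    by (simp_all add: bits R1 inner overlap overlap' t_def[symmetric])
  then have k1: "t * a 1 + (1 - t) * b 1 = a 0" "(1 - t) * a 1 + t * b 1 = b 0"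
    "t * a 0 + (1 - t) * b 0 = a 1" "(1 - t) * a 0 + t * b 0 = b 1"
    by (simp_all add: algebra_simps)
  \<comment> \<open>Each difference is \<open>2 * t - 1\<close> times the other, and
    \<open>1 - (2 * t - 1)^2 = 4 * t * (1 - t)\<close> is nonzero.\<close>
  have "a 0 - b 0 = (2 * t - 1) * (a 1 - b 1)"
    unfolding k1(1,2)[symmetric] by (simp add: algebra_simps)
  also have "a 1 - b 1 = (2 * t - 1) * (a 0 - b 0)"
    unfolding k1(3,4)[symmetric] by (simp add: algebra_simps)
  finally have "(4 * t * (1 - t)) * (a 0 - b 0) = 0"
    by (simp add: algebra_simps)
  then have ab0: "a 0 = b 0"
    using overlap(1,2) by simp
  define c where "c = a 0"
  \<comment> \<open>With \<open>a 0 = b 0\<close>, the values for basis 1 are convex combinations of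
    equal numbers.\<close>
  have c: "a 0 = c" "b 0 = c" "a 1 = c" "b 1 = c"
    using k1(3,4) ab0 by (auto simp: c_def algebra_simps)
  \<comment> \<open>The part of the report for counts \<open>(1, 1)\<close> that single photons do
    not determine: it appears when both detectors click.\<close>
  define g where "g \<beta> = e0 * e1 * (S 1 1 \<beta> - s)" for \<beta>
  have R2: "R \<beta> 2 0 = s + (2 - e0) * c" "R \<beta> 0 2 = s + (2 - e1) * c"
    "R \<beta> 1 1 = s + (2 - e0 - e1) * c + g \<beta>" if "\<beta> \<in> {0, 1}" for \<beta>
  proof -
    have c': "S 0 0 \<beta> = s" "e0 * (S 1 0 \<beta> - s) = c" "e1 * (S 0 1 \<beta> - s) = c"
      using that c s by (auto simp: a_def b_def)
    show "R \<beta> 2 0 = s + (2 - e0) * c"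
      using that c'(1) unfolding c'(2)[symmetric] by (simp add: R power2_eq_square algebra_simps)
    show "R \<beta> 0 2 = s + (2 - e1) * c"
      using that c'(1) unfolding c'(3)[symmetric] by (simp add: R power2_eq_square algebra_simps)
    have "R \<beta> 1 1 = s + (1 - e1) * (e0 * (S 1 0 \<beta> - s)) + (1 - e0) * (e1 * (S 0 1 \<beta> - s)) + g \<beta>"
      using that c'(1) by (simp add: R g_def algebra_simps)
    then show "R \<beta> 1 1 = s + (2 - e0 - e1) * c + g \<beta>"
      unfolding c'(2,3) by (simp add: algebra_simps)
  qed
  \<comment> \<open>\<open>x\<close> and \<open>y\<close> carry no basis index, because reports for
    two photons in the same detector already agree in both bases; only \<open>z\<close> can still
    depend on \<open>\<beta>\<close>.\<close>
  define x y z where "x = s + (2 - e0) * c" and "y = s + (2 - e1) * c"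
    and "z \<beta> = s + (2 - e0 - e1) * c + g \<beta>" for \<beta>
  note R2 = R2[folded x_def y_def z_def]
  have k2: "t * t * x + 2 * (t * (1 - t) * z 1) + (1 - t) * (1 - t) * y = x"
    "(1 - t) * (1 - t) * x + 2 * (t * (1 - t) * z 1) + t * t * y = y"
    "t * t * x + 2 * (t * (1 - t) * z 0) + (1 - t) * (1 - t) * y = x"
    using report[of 2 0 0] report[of 2 1 0] report[of 2 0 1, symmetric]
    by (simp_all add: bits R2 inner overlap overlap' mult_ac flip: t_def One_nat_def)
  \<comment> \<open>Subtracting the equations for the two states of basis 0 cancels the unknown
    \<open>z 1\<close>.\<close>
  have "(2 * t - 1) * (x - y)
      = (t * t * x + 2 * (t * (1 - t) * z 1) + (1 - t) * (1 - t) * y)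
        - ((1 - t) * (1 - t) * x + 2 * (t * (1 - t) * z 1) + t * t * y)"
    by (simp add: algebra_simps)
  also have "\<dots> = x - y"
    by (simp only: k2(1,2))
  finally have "(1 - t) * (x - y) = 0"
    by (simp add: algebra_simps)
  then have "x = y"
    using overlap(2) by simp
  \<comment> \<open>\<open>x = y\<close> says \<open>(e1 - e0) * c = 0\<close>; here the inequality
    of the efficiencies enters.\<close>
  then have c0: "c = 0"
    using e(5) by (simp add: x_def y_def)
  \<comment> \<open>With \<open>c = 0\<close> both \<open>x\<close> and \<open>y\<close> equal
    \<open>s\<close> and \<open>z \<beta> = s + g \<beta>\<close>. The weights add up to 1, so
    \<open>s\<close> cancels.\<close>
  then have "2 * t * (1 - t) * g 1 = 0" "2 * t * (1 - t) * g 0 = 0"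
    using k2(1,3) unfolding x_def y_def z_def by (simp_all add: algebra_simps)
  then have "g 0 = 0" "g 1 = 0"
    using overlap(1,2) by simp_all
  then have "S c0 c1 \<beta> = s" if "c0 \<in> {0, 1}" "c1 \<in> {0, 1}" "\<beta> \<in> {0, 1}" for c0 c1 \<beta>
    using that s c c0 e by (auto simp: a_def b_def g_def)
  \<comment> \<open>All entries equal \<open>s\<close>, so a strategy that is not identically zero
    has \<open>s\<close> nonzero.\<close>
  moreover have "s \<in> {0<..1}"
    using calculation assms(7,8) by (force simp: reporting_strategy_def)
  ultimately show "trivial_strategy S"
    unfolding trivial_strategy_def by blast
next
  assume "trivial_strategy S"
  then obtain s where "\<forall>c0 \<in> {0, 1}. \<forall>c1 \<in> {0, 1}. \<forall>\<beta> \<in> {0, 1}. S c0 c1 \<beta> = s"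
    unfolding trivial_strategy_def by blast
  then have S: "\<forall>c0 \<in> {0, 1}. \<forall>c1 \<in> {0, 1}. S c0 c1 \<beta> = s" if "\<beta> \<in> {0, 1}" for \<beta>
    using that by blast
  \<comment> \<open>Every outcome string is reported with probability \<open>s\<close>, and the
    strings have total probability 1, whatever the basis, the state and the number of
    photons.\<close>
  have "P_report \<psi> \<eta> d S \<beta> \<rho> k = s" if "\<beta> \<in> {0, 1}" "qubit_state k \<rho>" for \<beta> \<rho> k
  proof -
    have "P_report \<psi> \<eta> d S \<beta> \<rho> k = (\<Sum>x\<in>bit_lists k. outcome_prob \<psi> \<beta> \<rho> x) * s"
      by (simp only: P_report_eq_sum count_report_const[of S \<beta> s, OF S[OF that(1)]] sum_distrib_right)
    then show ?thesis
      using sum_outcome_prob[of \<psi> \<beta>, OF bspec[OF assms(1) that(1)] that(2)] by simp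
  qed
  then show "\<forall>k \<in> {0, 1, 2}. \<forall>\<rho>. qubit_state k \<rho> \<longrightarrow>
      P_report \<psi> \<eta> d S 1 \<rho> k = P_report \<psi> \<eta> d S 0 \<rho> k"
    by simp
qed

end
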